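(* Let $\phi_i(t,z):=\mathbb E\big(z^{Y(t)}1_{\{X(t)=i\}}\big)$ for $i=1,\dots,d$. Then for $i=1,\dots,d$, $$\frac{\partial}{\partial t}\phi_i(t,z)=\sum_{j=1}^d\phi_j(t,z)q_{ji}+\mu_i(1-z)\frac{\partial}{\partial z}\phi_i(t,z)+\lambda_iN(z-1)\phi_i(t,z)+\lambda_iz(1-z)\frac{\partial}{\partial z}\phi_i(t,z).$$ Moreover, if $(X,Y)$ has the stationary distribution of $(X(t),Y(t))_{t\ge0}$ and $\phi_i(z):=\mathbb E\big(z^Y1_{\{X=i\}}\big)$, then for $i=1,\dots,d$, $$0=\sum_{j=1}^d\phi_j(z)q_{ji}+\mu_i(1-z)\phi_i'(z)+\lambda_iN(z-1)\phi_i(z)+\lambda_iz(1-z)\phi_i'(z).$$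
   Context: $(X(t))_{t\ge0}$ is an irreducible continuous-time Markov process on $\{1,\dots,d\}$ with transition rate matrix $Q=(q_{ij})_{i,j=1}^d$. There are $N$ possible edges; while $X(t)=i$, each absent edge independently becomes present at rate $\lambda_i\ge0$ and each present edge independently becomes absent at rate $\mu_i\ge0$. $Y(t)\in\{0,\dots,N\}$ is the number of present edges at time $t$. Thus $(X(t),Y(t))$ is a Markov process with transitions $(i,m)\to(j,m)$ at rate $q_{ij}$ for $j\ne i$, $(i,m)\to(i,m+1)$ at rate $\lambda_i(N-m)$, and $(i,m)\to(i,m-1)$ at rate $\mu_im$. *)

theory Defs
  imports "HOL-Probability.Probability"
begin

definition transition_rate_matrix :: "'s set \<Rightarrow> ('s \<Rightarrow> 's \<Rightarrow> real) \<Rightarrow> bool" where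
  "transition_rate_matrix S q \<longleftrightarrow>
     (\<forall>i\<in>S. \<forall>j\<in>S. i \<noteq> j \<longrightarrow> 0 \<le> q i j) \<and> (\<forall>i\<in>S. (\<Sum>j\<in>S. q i j) = 0)"

definition irreducible_rates :: "'s set \<Rightarrow> ('s \<Rightarrow> 's \<Rightarrow> real) \<Rightarrow> bool" where
  "irreducible_rates S q \<longleftrightarrow>
     (\<forall>i\<in>S. \<forall>j\<in>S. (i, j) \<in> {(a, b). a \<in> S \<and> b \<in> S \<and> a \<noteq> b \<and> 0 < q a b}\<^sup>*)"

text \<open>The transition rate matrix whose off-diagonal entries are the jump rates \<open>r\<close>.\<close>

definition generator :: "'s set \<Rightarrow> ('s \<Rightarrow> 's \<Rightarrow> real) \<Rightarrow> 's \<Rightarrow> 's \<Rightarrow> real" where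
  "generator S r x y = (if x = y then - (\<Sum>s\<in>S - {x}. r x s) else r x y)"

text \<open>Transition function \<open>P t x y\<close> (\<open>t \<ge> 0\<close>) on a finite state space \<open>S\<close> with rates \<open>G\<close>:
  a semigroup of stochastic matrices with \<open>P h x y = (if x = y then 1 else 0) + h * G x y + o(h)\<close>
  as \<open>h\<close> decreases to 0. Only the values for \<open>t \<ge> 0\<close> and \<open>x, y \<in> S\<close> matter.\<close>

definition transition_function ::
    "'s set \<Rightarrow> ('s \<Rightarrow> 's \<Rightarrow> real) \<Rightarrow> (real \<Rightarrow> 's \<Rightarrow> 's \<Rightarrow> real) \<Rightarrow> bool" where
  "transition_function S G P \<longleftrightarrow>
     (\<forall>t\<ge>0. \<forall>x\<in>S. (\<forall>y\<in>S. 0 \<le> P t x y) \<and> (\<Sum>y\<in>S. P t x y) = 1) \<and>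
     (\<forall>x\<in>S. \<forall>y\<in>S. P 0 x y = (if x = y then 1 else 0)) \<and>
     (\<forall>s\<ge>0. \<forall>t\<ge>0. \<forall>x\<in>S. \<forall>y\<in>S. P (s + t) x y = (\<Sum>w\<in>S. P s x w * P t w y)) \<and>
     (\<forall>x\<in>S. \<forall>y\<in>S. ((\<lambda>t. P t x y) has_real_derivative G x y) (at 0 within {0..}))"

text \<open>A time-homogeneous Markov process on \<open>S\<close> with transition function \<open>P\<close> and arbitrary initial
  law. The Markov property is stated multiplied out, so that conditioning on null events needs no
  separate treatment.\<close>

definition markov_process ::
    "'w measure \<Rightarrow> 's set \<Rightarrow> (real \<Rightarrow> 's \<Rightarrow> 's \<Rightarrow> real) \<Rightarrow> (real \<Rightarrow> 'w \<Rightarrow> 's) \<Rightarrow> bool" where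
  "markov_process M S P Z \<longleftrightarrow>
     prob_space M \<and>
     (\<forall>t\<ge>0. Z t \<in> measurable M (count_space S)) \<and>
     (\<forall>(n::nat) (\<tau> :: nat \<Rightarrow> real) (s :: nat \<Rightarrow> 's).
        0 \<le> \<tau> 0 \<longrightarrow> (\<forall>k\<le>n. \<tau> k < \<tau> (Suc k)) \<longrightarrow> (\<forall>k\<le>Suc n. s k \<in> S) \<longrightarrow>
        measure M {\<omega> \<in> space M. \<forall>k\<le>Suc n. Z (\<tau> k) \<omega> = s k} =
        measure M {\<omega> \<in> space M. \<forall>k\<le>n. Z (\<tau> k) \<omega> = s k} *
          P (\<tau> (Suc n) - \<tau> n) (s n) (s (Suc n)))"

definition stationary_distribution ::
    "'s set \<Rightarrow> (real \<Rightarrow> 's \<Rightarrow> 's \<Rightarrow> real) \<Rightarrow> 's pmf \<Rightarrow> bool" where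
  "stationary_distribution S P \<pi> \<longleftrightarrow>
     set_pmf \<pi> \<subseteq> S \<and>
     (\<forall>t\<ge>0. \<forall>y\<in>S. (\<Sum>x\<in>S. pmf \<pi> x * P t x y) = pmf \<pi> y)"

text \<open>States are pairs (background state, number of present edges).\<close>

definition edge_states :: "nat \<Rightarrow> nat \<Rightarrow> (nat \<times> nat) set" where
  "edge_states d N = {1..d} \<times> {0..N}"

fun edge_jump_rate ::
    "(nat \<Rightarrow> nat \<Rightarrow> real) \<Rightarrow> (nat \<Rightarrow> real) \<Rightarrow> (nat \<Rightarrow> real) \<Rightarrow> nat \<Rightarrow> nat \<times> nat \<Rightarrow> nat \<times> nat \<Rightarrow> real" where
  "edge_jump_rate q lam mu N (i, m) (j, n) =
     (if j \<noteq> i \<and> n = m then q i j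
      else if j = i \<and> n = m + 1 then lam i * (real N - real m)
      else if j = i \<and> m = n + 1 then mu i * real m
      else 0)"

definition edge_generator ::
    "nat \<Rightarrow> (nat \<Rightarrow> nat \<Rightarrow> real) \<Rightarrow> (nat \<Rightarrow> real) \<Rightarrow> (nat \<Rightarrow> real) \<Rightarrow> nat \<Rightarrow> nat \<times> nat \<Rightarrow> nat \<times> nat \<Rightarrow> real" where
  "edge_generator d q lam mu N = generator (edge_states d N) (edge_jump_rate q lam mu N)"

definition partial_pgf ::
    "'w measure \<Rightarrow> ('w \<Rightarrow> nat) \<Rightarrow> ('w \<Rightarrow> nat) \<Rightarrow> nat \<Rightarrow> real \<Rightarrow> real" where
  "partial_pgf M X Y i z = (\<integral>\<omega>. z ^ Y \<omega> * indicator {\<omega>'. X \<omega>' = i} \<omega> \<partial>M)"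

end

theory Submission
  imports Defs
begin

text \<open>The law \<open>p t\<close> of the process at time \<open>t\<close> satisfies \<open>p (t + h) = p t P h\<close>, so Kolmogorov's forward
  equation \<open>p' = p G\<close> follows from the derivative of \<open>P\<close> at \<open>0\<close>
  (\<open>forward_equation\<close>, \<open>markov_process_law_evolution\<close>). Since at most \<open>N\<close> edges are present, the
  partial generating function is the polynomial \<open>\<Sum>m\<le>N. p t (i, m) * z ^ m\<close>
  (\<open>partial_pgf_eq_sum\<close>); differentiating in \<open>t\<close> is therefore a finite sum of forward equations.
  The claim reduces to an identity for an arbitrary weight function \<open>p\<close>: the sum of
  \<open>(p G) (i, m) * z ^ m\<close> is the right-hand side of the differential equation
  (\<open>edge_generator_pgf\<close>). It holds because the birth and death rates are affine in the number of
  edges, and multiplying the coefficient of \<open>z ^ m\<close> by \<open>m\<close> amounts to applying \<open>z * d/dz\<close>.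

  A stationary law is a constant solution \<open>\<pi>\<close> of the same evolution, hence \<open>\<pi> G = 0\<close>
  (\<open>stationary_distribution_balance\<close>), and the same identity with weights \<open>\<pi>\<close> gives the second
  equation.\<close>

section \<open>The forward equation on a finite state space\<close>

lemma transition_functionD:
  assumes "transition_function S G P"
  shows "x \<in> S \<Longrightarrow> y \<in> S \<Longrightarrow> P 0 x y = (if x = y then 1 else 0)"
    and "x \<in> S \<Longrightarrow> y \<in> S \<Longrightarrow> ((\<lambda>t. P t x y) has_real_derivative G x y) (at 0 within {0..})"
  using assms unfolding transition_function_def by blast+

text \<open>For \<open>s \<noteq> t\<close> both one-sided difference quotients have the same form: propagate for time
  \<open>\<bar>s - t\<bar>\<close> from the earlier time \<open>min s t\<close>. Hence both sides are handled in one limit. The factor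
  \<open>p (min s t) w\<close> converges because boundedness of \<open>p\<close> and the identity for the increments force
  \<open>p\<close> to be continuous.\<close>

lemma forward_equation:
  fixes p :: "real \<Rightarrow> 's \<Rightarrow> real"
  assumes "finite S"
    and P: "transition_function S G P"
    and evol: "\<And>s h y. 0 \<le> s \<Longrightarrow> 0 \<le> h \<Longrightarrow> y \<in> S \<Longrightarrow> p (s + h) y = (\<Sum>w\<in>S. p s w * P h w y)"
    and bounded: "\<And>s w. 0 \<le> s \<Longrightarrow> w \<in> S \<Longrightarrow> \<bar>p s w\<bar> \<le> B"
    and "0 \<le> t" "y \<in> S"
  shows "((\<lambda>s. p s y) has_real_derivative (\<Sum>w\<in>S. p t w * G w y)) (at t within {0..})"
proof -
  let ?F = "at t within {0..} :: real filter"
  let ?\<Delta> = "\<lambda>h w y. P h w y - (if w = y then 1 else 0 :: real)"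
  let ?h = "\<lambda>s. \<bar>s - t\<bar>"
  have increment: "p (a + h) y - p a y = (\<Sum>w\<in>S. p a w * ?\<Delta> h w y)"
    if "0 \<le> a" "0 \<le> h" "y \<in> S" for a h y
  proof -
    have "(\<Sum>w\<in>S. p a w * (if w = y then 1 else 0)) = p a y"
      using \<open>finite S\<close> that(3) by (simp add: if_distrib cong: if_cong)
    then show ?thesis
      using evol[OF that] by (simp add: right_diff_distrib sum_subtractf)
  qed
  have gap: "filterlim ?h (at 0 within {0..}) ?F"
    unfolding filterlim_at
    by (auto intro!: tendsto_eq_intros simp: eventually_at_filter)
  have quotient: "((\<lambda>s. ?\<Delta> (?h s) w y / ?h s) \<longlongrightarrow> G w y) ?F"
    if "w \<in> S" "y \<in> S" for w y
  proof -
    have "((\<lambda>h. ?\<Delta> h w y / h) \<longlongrightarrow> G w y) (at 0 within {0..})"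
      using transition_functionD[OF P that] by (simp add: has_field_derivative_iff)
    from filterlim_compose[OF this gap] show ?thesis .
  qed
  have vanish: "((\<lambda>s. ?\<Delta> (?h s) w y) \<longlongrightarrow> 0) ?F" if "w \<in> S" "y \<in> S" for w y
  proof -
    have "((\<lambda>s. ?\<Delta> (?h s) w y / ?h s * ?h s) \<longlongrightarrow> G w y * \<bar>t - t\<bar>) ?F"
      by (intro tendsto_intros quotient that)
    moreover have "\<forall>\<^sub>F s in ?F. ?\<Delta> (?h s) w y / ?h s * ?h s
        = ?\<Delta> (?h s) w y"
      by (auto simp: eventually_at_filter)
    ultimately show ?thesis
      by (simp add: tendsto_cong)
  qed
  have continuous: "((\<lambda>s. p (min s t) v) \<longlongrightarrow> p t v) ?F" if "v \<in> S" for v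
  proof -
    have bound: "\<forall>\<^sub>F s in ?F. norm (p (min s t) v - p t v) \<le> (\<Sum>w\<in>S. B * \<bar>?\<Delta> (?h s) w v\<bar>)"
      unfolding eventually_at_filter
    proof (intro always_eventually allI impI)
      fix s :: real assume "s \<in> {0..}"
      then have s: "0 \<le> min s t" using \<open>0 \<le> t\<close> by simp
      have "\<bar>p (min s t) v - p t v\<bar> \<le> \<bar>p (min s t + ?h s) v - p (min s t) v\<bar>"
        by (cases "s \<le> t") (auto simp: min_def)
      also have "\<dots> \<le> (\<Sum>w\<in>S. \<bar>p (min s t) w * ?\<Delta> (?h s) w v\<bar>)"
        by (subst increment) (use s that in auto)
      also have "\<dots> \<le> (\<Sum>w\<in>S. B * \<bar>?\<Delta> (?h s) w v\<bar>)"
        using bounded[OF s] by (intro sum_mono) (auto simp: abs_mult intro!: mult_right_mono)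
      finally show "norm (p (min s t) v - p t v) \<le> (\<Sum>w\<in>S. B * \<bar>?\<Delta> (?h s) w v\<bar>)"
        by simp
    qed
    have "((\<lambda>s. \<Sum>w\<in>S. B * \<bar>?\<Delta> (?h s) w v\<bar>) \<longlongrightarrow> (\<Sum>w\<in>S. B * \<bar>0\<bar>)) ?F"
      by (intro tendsto_intros vanish that)
    then have "((\<lambda>s. \<Sum>w\<in>S. B * \<bar>?\<Delta> (?h s) w v\<bar>) \<longlongrightarrow> 0) ?F"
      by simp
    from Lim_null_comparison[OF bound this] show ?thesis
      by (rule Lim_null[THEN iffD2])
  qed
  have "((\<lambda>s. \<Sum>w\<in>S. p (min s t) w * (?\<Delta> (?h s) w y / ?h s))
      \<longlongrightarrow> (\<Sum>w\<in>S. p t w * G w y)) ?F"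
    by (intro tendsto_intros continuous quotient \<open>y \<in> S\<close>)
  moreover have "\<forall>\<^sub>F s in ?F. (\<Sum>w\<in>S. p (min s t) w * (?\<Delta> (?h s) w y / ?h s))
      = (p s y - p t y) / (s - t)"
    unfolding eventually_at_filter
  proof (intro always_eventually allI impI)
    fix s :: real assume s: "s \<noteq> t" "s \<in> {0..}"
    have "(\<Sum>w\<in>S. p (min s t) w * (?\<Delta> (?h s) w y / ?h s))
        = (p (min s t + ?h s) y - p (min s t) y) / ?h s"
      by (subst increment) (use s \<open>0 \<le> t\<close> \<open>y \<in> S\<close> in \<open>auto simp: sum_divide_distrib\<close>)
    also have "\<dots> = (p s y - p t y) / (s - t)"
    proof (cases "s < t")
      case True
      then have "?h s = - (s - t)" "min s t = s" "min s t + ?h s = t" by auto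
      then show ?thesis by (metis minus_diff_eq minus_divide_divide)
    qed (use s in auto)
    finally show "(\<Sum>w\<in>S. p (min s t) w * (?\<Delta> (?h s) w y / ?h s))
        = (p s y - p t y) / (s - t)" .
  qed
  ultimately show ?thesis
    by (simp add: has_field_derivative_iff tendsto_cong)
qed

text \<open>The Markov property for the two times \<open>s < s + h\<close> gives the joint law; summing over the state
  at time \<open>s\<close> leaves the law at time \<open>s + h\<close>. The times of that property are strictly increasing,
  so \<open>h = 0\<close> is a separate case, covered by \<open>P 0\<close> being the identity.\<close>

lemma markov_process_law_evolution:
  assumes Z: "markov_process M S P Z"
    and P: "transition_function S G P"
    and "finite S" "0 \<le> s" "0 \<le> h" "y \<in> S"
  shows "measure M {\<omega> \<in> space M. Z (s + h) \<omega> = y}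
    = (\<Sum>w\<in>S. measure M {\<omega> \<in> space M. Z s \<omega> = w} * P h w y)"
proof (cases "h = 0")
  case True
  have "(\<Sum>w\<in>S. measure M {\<omega> \<in> space M. Z s \<omega> = w} * P h w y)
      = (\<Sum>w\<in>S. if w = y then measure M {\<omega> \<in> space M. Z s \<omega> = w} else 0)"
    using transition_functionD(1)[OF P _ \<open>y \<in> S\<close>] True by (intro sum.cong) auto
  then show ?thesis
    using True \<open>finite S\<close> \<open>y \<in> S\<close> by simp
next
  case False
  interpret prob_space M using Z by (simp add: markov_process_def)
  have meas: "Z u \<in> measurable M (count_space S)" if "0 \<le> u" for u
    using Z that by (simp add: markov_process_def)
  have level: "{\<omega> \<in> space M. Z u \<omega> = v} \<in> sets M" if "0 \<le> u" "v \<in> S" for u v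
    using measurable_sets[OF meas[OF that(1)], of "{v}"] that(2)
    by (simp add: vimage_def Int_def conj_commute)
  have joint: "measure M {\<omega> \<in> space M. Z s \<omega> = w \<and> Z (s + h) \<omega> = y}
      = measure M {\<omega> \<in> space M. Z s \<omega> = w} * P h w y" if "w \<in> S" for w
  proof -
    have two: "(\<forall>k\<le>Suc 0. Q k) \<longleftrightarrow> Q 0 \<and> Q (Suc 0)" for Q
      by (auto simp: le_Suc_eq)
    \<comment> \<open>The Markov property with \<open>n = 0\<close>, that is, with a single past time.\<close>
    have "\<forall>(\<tau> :: nat \<Rightarrow> real) (v :: nat \<Rightarrow> _). 0 \<le> \<tau> 0 \<longrightarrow> \<tau> 0 < \<tau> (Suc 0)
        \<longrightarrow> v 0 \<in> S \<and> v (Suc 0) \<in> S \<longrightarrow>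
        measure M {\<omega> \<in> space M. Z (\<tau> 0) \<omega> = v 0 \<and> Z (\<tau> (Suc 0)) \<omega> = v (Suc 0)} =
        measure M {\<omega> \<in> space M. Z (\<tau> 0) \<omega> = v 0} * P (\<tau> (Suc 0) - \<tau> 0) (v 0) (v (Suc 0))"
      using Z unfolding markov_process_def
      by (elim conjE, drule_tac x = 0 in spec) (simp add: two)
    from this[rule_format, of "\<lambda>k. if k = 0 then s else s + h" "\<lambda>k. if k = 0 then w else y"]
    show ?thesis using False assms that by simp
  qed
  have "measure M {\<omega> \<in> space M. Z (s + h) \<omega> = y}
      = measure M (\<Union>w\<in>S. {\<omega> \<in> space M. Z s \<omega> = w \<and> Z (s + h) \<omega> = y})"
    using measurable_space[OF meas[OF \<open>0 \<le> s\<close>]] by (intro arg_cong[of _ _ "measure M"]) auto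
  also have "\<dots> = (\<Sum>w\<in>S. measure M {\<omega> \<in> space M. Z s \<omega> = w \<and> Z (s + h) \<omega> = y})"
  proof (rule finite_measure_finite_Union[OF \<open>finite S\<close>])
    have "{\<omega> \<in> space M. Z s \<omega> = w \<and> Z (s + h) \<omega> = y} \<in> sets M" if "w \<in> S" for w
    proof -
      have "{\<omega> \<in> space M. Z s \<omega> = w \<and> Z (s + h) \<omega> = y}
          = {\<omega> \<in> space M. Z s \<omega> = w} \<inter> {\<omega> \<in> space M. Z (s + h) \<omega> = y}" by auto
      then show ?thesis using level assms that by auto
    qed
    then show "(\<lambda>w. {\<omega> \<in> space M. Z s \<omega> = w \<and> Z (s + h) \<omega> = y}) ` S \<subseteq> sets M"
      by blast
  qed (auto simp: disjoint_family_on_def)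
  finally show ?thesis by (simp add: joint)
qed

text \<open>The constant curve \<open>\<lambda>_. pmf \<pi>\<close> satisfies the hypotheses of the forward equation, so the
  right-hand side of that equation is the derivative of a constant. It is evaluated at the interior
  time \<open>1\<close>, where the derivative within \<open>{0..}\<close> is the ordinary one and thus unique.\<close>

lemma stationary_distribution_balance:
  assumes "stationary_distribution S P \<pi>" and P: "transition_function S G P"
    and "finite S" "y \<in> S"
  shows "(\<Sum>w\<in>S. pmf \<pi> w * G w y) = 0"
proof -
  have "((\<lambda>s. pmf \<pi> y) has_real_derivative (\<Sum>w\<in>S. pmf \<pi> w * G w y)) (at 1 within {0..})"
    by (rule forward_equation[OF \<open>finite S\<close> P, where p = "\<lambda>_. pmf \<pi>" and B = 1])
       (use assms in \<open>auto simp: stationary_distribution_def pmf_le_1\<close>)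
  moreover have "at 1 within {0..} = (at 1 :: real filter)"
    by (rule at_within_interior) (simp add: interior_Ici[where b = "-1"])
  ultimately show ?thesis
    using DERIV_unique DERIV_const by metis
qed

section \<open>The generator of the edge process\<close>

text \<open>As the rows of a generator sum to \<open>0\<close>, the diagonal entry can be absorbed into increments
  of \<open>f\<close>. The increment at \<open>y = x\<close> is \<open>0\<close>, so the new sum can run over all of \<open>S\<close>, which for a
  product space splits into iterated sums.\<close>

lemma generator_apply:
  assumes "finite S" "x \<in> S"
  shows "(\<Sum>y\<in>S. generator S r x y * f y) = (\<Sum>y\<in>S. r x y * (f y - f x))"
proof -
  have "(\<Sum>y\<in>S. generator S r x y * f y)
      = generator S r x x * f x + (\<Sum>y\<in>S - {x}. generator S r x y * f y)"
    using assms by (simp add: sum.remove)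
  also have "\<dots> = (\<Sum>y\<in>S - {x}. r x y * (f y - f x))"
  proof -
    have "generator S r x x * f x = - (\<Sum>y\<in>S - {x}. r x y * f x)"
      by (simp add: generator_def sum_distrib_right)
    moreover have "(\<Sum>y\<in>S - {x}. generator S r x y * f y) = (\<Sum>y\<in>S - {x}. r x y * f y)"
      by (intro sum.cong) (auto simp: generator_def)
    ultimately show ?thesis
      by (simp add: right_diff_distrib sum_subtractf)
  qed
  also have "\<dots> = (\<Sum>y\<in>S. r x y * (f y - f x))"
    using assms by (simp add: sum.remove)
  finally show ?thesis .
qed

lemma finite_edge_states: "finite (edge_states d N)"
  by (simp add: edge_states_def)

text \<open>The terms at \<open>n + 1\<close> and \<open>n - 1\<close> are correct at the boundary as well: the rate
  \<open>lam k * (N - n)\<close> vanishes for \<open>n = N\<close>, where \<open>n + 1\<close> leaves the state space, and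
  \<open>mu k * n\<close> vanishes for \<open>n = 0\<close>, where \<open>n - 1\<close> is truncated.\<close>

lemma edge_generator_apply:
  assumes q: "transition_rate_matrix {1..d} q" and k: "k \<in> {1..d}" and n: "n \<le> N"
  shows "(\<Sum>y\<in>edge_states d N. edge_generator d q lam mu N (k, n) y * f y)
    = (\<Sum>j=1..d. q k j * f (j, n))
      + lam k * (real N - real n) * (f (k, n + 1) - f (k, n))
      + mu k * real n * (f (k, n - 1) - f (k, n))"
proof -
  let ?r = "edge_jump_rate q lam mu N"
  let ?D = "\<lambda>y. f y - f (k, n)"
  have other: "(\<Sum>m=0..N. ?r (k, n) (j, m) * ?D (j, m)) = q k j * ?D (j, n)" if "j \<noteq> k" for j
  proof -
    have "(\<Sum>m=0..N. ?r (k, n) (j, m) * ?D (j, m))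
        = (\<Sum>m=0..N. if m = n then q k j * ?D (j, n) else 0)"
      using that by (intro sum.cong) auto
    then show ?thesis using n by simp
  qed
  have same: "(\<Sum>m=0..N. ?r (k, n) (k, m) * ?D (k, m))
      = lam k * (real N - real n) * ?D (k, n + 1) + mu k * real n * ?D (k, n - 1)"
  proof -
    have "(\<Sum>m=0..N. ?r (k, n) (k, m) * ?D (k, m))
        = (\<Sum>m=0..N. (if m = n + 1 then lam k * (real N - real n) * ?D (k, n + 1) else 0)
            + (if m = n - 1 then mu k * real n * ?D (k, n - 1) else 0))"
      by (intro sum.cong) auto
    also have "\<dots> = lam k * (real N - real n) * ?D (k, n + 1) + mu k * real n * ?D (k, n - 1)"
      using n by (auto simp: sum.distrib)
    finally show ?thesis .
  qed
  have rows: "(\<Sum>j=1..d. q k j) = 0"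
    using q k by (auto simp: transition_rate_matrix_def)
  have "(\<Sum>y\<in>edge_states d N. edge_generator d q lam mu N (k, n) y * f y)
      = (\<Sum>y\<in>edge_states d N. ?r (k, n) y * ?D y)"
    unfolding edge_generator_def using k n
    by (intro generator_apply) (auto simp: edge_states_def)
  also have "\<dots> = (\<Sum>j=1..d. \<Sum>m=0..N. ?r (k, n) (j, m) * ?D (j, m))"
    by (simp only: edge_states_def sum.cartesian_product split_def prod.collapse)
  also have "\<dots> = (\<Sum>m=0..N. ?r (k, n) (k, m) * ?D (k, m)) + (\<Sum>j\<in>{1..d} - {k}. q k j * ?D (j, n))"
    using k by (subst sum.remove[of "{1..d}" k]) (auto simp: other simp del: edge_jump_rate.simps intro!: sum.cong)
  also have "(\<Sum>j\<in>{1..d} - {k}. q k j * ?D (j, n)) = (\<Sum>j=1..d. q k j * ?D (j, n))"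
    using k by (subst sum.remove[of "{1..d}" k]) simp_all
  also have "\<dots> = (\<Sum>j=1..d. q k j * f (j, n))"
    using rows by (simp add: right_diff_distrib sum_subtractf flip: sum_distrib_right)
  finally show ?thesis using same by simp
qed

section \<open>Partial generating functions\<close>

lemma partial_pgf_eq_sum:
  fixes z :: real
  assumes "prob_space M"
    and meas: "(\<lambda>\<omega>. (X \<omega>, Y \<omega>)) \<in> measurable M (count_space UNIV)"
    and bound: "AE \<omega> in M. Y \<omega> \<le> N"
  shows "partial_pgf M X Y i z
    = (\<Sum>m=0..N. measure M {\<omega> \<in> space M. (X \<omega>, Y \<omega>) = (i, m)} * z ^ m)"
proof -
  interpret prob_space M by fact
  have comp: "(\<lambda>\<omega>. f (X \<omega>, Y \<omega>)) \<in> borel_measurable M" for f :: "nat \<times> nat \<Rightarrow> real"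
    using measurable_compose[OF meas, of f borel] by simp
  have level: "{\<omega> \<in> space M. (X \<omega>, Y \<omega>) = y} \<in> sets M" for y
    using measurable_sets[OF meas, of "{y}"] by (simp add: vimage_def Int_def conj_commute)
  let ?A = "\<lambda>m. {\<omega> \<in> space M. (X \<omega>, Y \<omega>) = (i, m)}"
  have "partial_pgf M X Y i z = (\<integral>\<omega>. (\<Sum>m=0..N. indicator (?A m) \<omega> * z ^ m) \<partial>M)"
    unfolding partial_pgf_def
  proof (rule integral_cong_AE)
    show "(\<lambda>\<omega>. z ^ Y \<omega> * indicator {\<omega>'. X \<omega>' = i} \<omega>) \<in> borel_measurable M"
      using comp[of "\<lambda>y. z ^ snd y * indicator {i} (fst y)"] by (simp add: indicator_def)
    show "(\<lambda>\<omega>. \<Sum>m=0..N. indicator (?A m) \<omega> * z ^ m) \<in> borel_measurable M"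
      by (intro borel_measurable_sum borel_measurable_times borel_measurable_indicator level) simp
    have "z ^ Y \<omega> * indicator {\<omega>'. X \<omega>' = i} \<omega> = (\<Sum>m=0..N. indicator (?A m) \<omega> * z ^ m)"
      if "Y \<omega> \<le> N" "\<omega> \<in> space M" for \<omega>
    proof -
      have "(\<Sum>m=0..N. indicator (?A m) \<omega> * z ^ m)
          = (\<Sum>m=0..N. if m = Y \<omega> then z ^ Y \<omega> * indicator {\<omega>'. X \<omega>' = i} \<omega> else 0)"
        using that by (intro sum.cong) (auto simp: indicator_def)
      then show ?thesis using that by simp
    qed
    with bound show "AE \<omega> in M. z ^ Y \<omega> * indicator {\<omega>'. X \<omega>' = i} \<omega>
        = (\<Sum>m=0..N. indicator (?A m) \<omega> * z ^ m)" by auto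
  qed
  also have "\<dots> = (\<Sum>m=0..N. measure M (?A m) * z ^ m)"
    using level by (subst Bochner_Integration.integral_sum) (auto simp: less_top[symmetric])
  finally show ?thesis .
qed

lemma power_sum_has_derivative:
  fixes a :: "nat \<Rightarrow> real"
  shows "((\<lambda>w. \<Sum>m=0..N. a m * w ^ m) has_real_derivative
    (\<Sum>m=0..N. a m * (real m * z ^ (m - 1)))) (at z)"
  by (auto intro!: derivative_eq_intros sum.cong simp: mult_ac)

text \<open>By exchanging sums the left side is the integral against \<open>p\<close> of the generator applied to the
  test function \<open>(j, m) \<mapsto> z^m * 1(j = i)\<close>. Its birth part at level \<open>n\<close> is
  \<open>(N - n) * (z^(n+1) - z^n) = N * (z - 1) * z^n + z * (1 - z) * n * z^(n-1)\<close>, which turns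
  multiplication by \<open>n\<close> into differentiation in \<open>z\<close>; the death part is
  \<open>n * (z^(n-1) - z^n) = (1 - z) * n * z^(n-1)\<close>. Jumps of the background state leave \<open>m\<close>
  unchanged and contribute \<open>q j i * z^n\<close>.\<close>

lemma edge_generator_pgf:
  fixes p :: "nat \<times> nat \<Rightarrow> real"
  assumes q: "transition_rate_matrix {1..d} q" and i: "i \<in> {1..d}"
    and g: "\<And>j z. g j z = (\<Sum>m=0..N. p (j, m) * z ^ m)"
  shows "(\<Sum>m=0..N. (\<Sum>w\<in>edge_states d N. p w * edge_generator d q lam mu N w (i, m)) * z ^ m)
    = (\<Sum>j=1..d. g j z * q j i) + mu i * (1 - z) * deriv (g i) z
      + lam i * real N * (z - 1) * g i z + lam i * z * (1 - z) * deriv (g i) z"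
proof -
  let ?S = "edge_states d N" and ?G = "edge_generator d q lam mu N"
  define f where "f y = (if fst y = i then z ^ snd y else 0)" for y :: "nat \<times> nat"
  define c where "c n = lam i * (real N - real n) * (z ^ (n + 1) - z ^ n)
      + mu i * real n * (z ^ (n - 1) - z ^ n)" for n
  have "g i = (\<lambda>w. \<Sum>m=0..N. p (i, m) * w ^ m)"
    using g by auto
  then have g': "deriv (g i) z = (\<Sum>m=0..N. p (i, m) * (real m * z ^ (m - 1)))"
    by (simp add: DERIV_imp_deriv[OF power_sum_has_derivative])
  have f_sum: "(\<Sum>y\<in>?S. h y * f y) = (\<Sum>m=0..N. h (i, m) * z ^ m)" for h
  proof -
    have "(\<Sum>y\<in>?S. h y * f y) = (\<Sum>j=1..d. \<Sum>m=0..N. h (j, m) * f (j, m))"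
      by (simp only: edge_states_def sum.cartesian_product split_def prod.collapse)
    also have "\<dots> = (\<Sum>j=1..d. if j = i then \<Sum>m=0..N. h (i, m) * z ^ m else 0)"
      by (intro sum.cong) (auto simp: f_def)
    finally show ?thesis using i by simp
  qed
  have G_f: "(\<Sum>y\<in>?S. ?G (k, n) y * f y) = q k i * z ^ n + (if k = i then c n else 0)"
    if "k \<in> {1..d}" "n \<le> N" for k n
  proof -
    have "(\<Sum>j=1..d. q k j * f (j, n)) = q k i * z ^ n"
      using i by (simp add: f_def if_distrib cong: if_cong)
    then show ?thesis
      unfolding edge_generator_apply[OF q that] by (simp add: f_def c_def)
  qed
  have "(\<Sum>m=0..N. (\<Sum>w\<in>?S. p w * ?G w (i, m)) * z ^ m)
      = (\<Sum>w\<in>?S. p w * (\<Sum>y\<in>?S. ?G w y * f y))"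
    unfolding f_sum
    by (simp only: sum_distrib_left sum_distrib_right mult.assoc) (rule sum.swap)
  also have "\<dots> = (\<Sum>k=1..d. \<Sum>n=0..N. p (k, n) * (\<Sum>y\<in>?S. ?G (k, n) y * f y))"
    by (simp only: edge_states_def sum.cartesian_product split_def prod.collapse)
  also have "\<dots> = (\<Sum>k=1..d. \<Sum>n=0..N. p (k, n) * (q k i * z ^ n + (if k = i then c n else 0)))"
    by (intro sum.cong) (auto simp: G_f)
  also have "\<dots> = (\<Sum>k=1..d. g k z * q k i)
      + (\<Sum>k=1..d. if k = i then \<Sum>n=0..N. p (i, n) * c n else 0)"
    unfolding g sum.distrib[symmetric]
    by (intro sum.cong) (auto simp: distrib_left sum.distrib sum_distrib_left sum_distrib_right mult_ac)
  also have "(\<Sum>k=1..d. if k = i then \<Sum>n=0..N. p (i, n) * c n else 0) = (\<Sum>n=0..N. p (i, n) * c n)"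
    using i by simp
  also have "(\<Sum>n=0..N. p (i, n) * c n) = mu i * (1 - z) * deriv (g i) z
      + lam i * real N * (z - 1) * g i z + lam i * z * (1 - z) * deriv (g i) z"
    unfolding g' g sum_distrib_left sum.distrib[symmetric]
  proof (rule sum.cong)
    fix n
    show "p (i, n) * c n = mu i * (1 - z) * (p (i, n) * (real n * z ^ (n - 1)))
        + lam i * real N * (z - 1) * (p (i, n) * z ^ n)
        + lam i * z * (1 - z) * (p (i, n) * (real n * z ^ (n - 1)))"
      by (cases n) (simp_all add: c_def algebra_simps)
  qed simp
  finally show ?thesis by simp
qed

theorem mainTheorem4:
  fixes d N :: nat
    and q :: "nat \<Rightarrow> nat \<Rightarrow> real" and lam mu :: "nat \<Rightarrow> real"
    and P :: "real \<Rightarrow> nat \<times> nat \<Rightarrow> nat \<times> nat \<Rightarrow> real"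
    and M :: "'w measure" and X Y :: "real \<Rightarrow> 'w \<Rightarrow> nat"
    and \<phi> :: "nat \<Rightarrow> real \<Rightarrow> real \<Rightarrow> real"
  assumes "transition_rate_matrix {1..d} q"
    and "irreducible_rates {1..d} q"
    and "\<And>i. i \<in> {1..d} \<Longrightarrow> 0 \<le> lam i"
    and "\<And>i. i \<in> {1..d} \<Longrightarrow> 0 \<le> mu i"
    and "transition_function (edge_states d N) (edge_generator d q lam mu N) P"
    and "markov_process M (edge_states d N) P (\<lambda>t \<omega>. (X t \<omega>, Y t \<omega>))"
    and "\<And>i t z. \<phi> i t z = partial_pgf M (X t) (Y t) i z"
  shows "(\<forall>i\<in>{1..d}. \<forall>t\<ge>0. \<forall>z::real.
      (\<lambda>w. \<phi> i t w) differentiable (at z) \<and>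
      ((\<lambda>s. \<phi> i s z) has_real_derivative
         ((\<Sum>j=1..d. \<phi> j t z * q j i)
          + mu i * (1 - z) * deriv (\<lambda>w. \<phi> i t w) z
          + lam i * real N * (z - 1) * \<phi> i t z
          + lam i * z * (1 - z) * deriv (\<lambda>w. \<phi> i t w) z)) (at t within {0..})) \<and>
    (\<forall>(\<pi> :: (nat \<times> nat) pmf) (M' :: 'v measure) (X' :: 'v \<Rightarrow> nat) (Y' :: 'v \<Rightarrow> nat)
           (\<psi> :: nat \<Rightarrow> real \<Rightarrow> real).
      stationary_distribution (edge_states d N) P \<pi> \<longrightarrow>
      prob_space M' \<longrightarrow>
      (\<lambda>\<omega>. (X' \<omega>, Y' \<omega>)) \<in> measurable M' (count_space UNIV) \<longrightarrow>
      distr M' (count_space UNIV) (\<lambda>\<omega>. (X' \<omega>, Y' \<omega>)) = measure_pmf \<pi> \<longrightarrow>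
      (\<forall>i z. \<psi> i z = partial_pgf M' X' Y' i z) \<longrightarrow>
      (\<forall>i\<in>{1..d}. \<forall>z::real.
        \<psi> i differentiable (at z) \<and>
        0 = (\<Sum>j=1..d. \<psi> j z * q j i)
            + mu i * (1 - z) * deriv (\<psi> i) z
            + lam i * real N * (z - 1) * \<psi> i z
            + lam i * z * (1 - z) * deriv (\<psi> i) z))"
proof (intro conjI ballI allI impI)
  let ?S = "edge_states d N" and ?G = "edge_generator d q lam mu N"
  \<comment> \<open>By linearity in the law, the equations for \<open>\<phi>\<close> and \<open>\<psi>\<close> come from those for the point
     probabilities, weighted with \<open>z ^ m\<close>.\<close>
  define p where "p t y = measure M {\<omega> \<in> space M. (X t \<omega>, Y t \<omega>) = y}" for t y
  have M: "prob_space M"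
    and XY: "(\<lambda>\<omega>. (X t \<omega>, Y t \<omega>)) \<in> measurable M (count_space ?S)" if "0 \<le> t" for t :: real
    using assms(6) that by (simp_all add: markov_process_def)
  interpret prob_space M using assms(6) by (simp add: markov_process_def)
  have phi: "\<phi> j t z = (\<Sum>m=0..N. p t (j, m) * z ^ m)" if "0 \<le> t" for j t and z :: real
    unfolding assms(7) p_def
  proof (rule partial_pgf_eq_sum[OF M[OF that]])
    show "(\<lambda>\<omega>. (X t \<omega>, Y t \<omega>)) \<in> measurable M (count_space UNIV)"
      using measurable_compose[OF XY[OF that], of "\<lambda>y. y" "count_space UNIV"] by simp
    show "AE \<omega> in M. Y t \<omega> \<le> N"
      using measurable_space[OF XY[OF that]] by (intro AE_I2) (auto simp: edge_states_def)
  qed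
  {
    fix i and t z :: real assume i: "i \<in> {1..d}" and t: "0 \<le> t"
    show "(\<lambda>w. \<phi> i t w) differentiable (at z)"
      using power_sum_has_derivative[of "\<lambda>m. p t (i, m)"] phi[OF t]
      by (auto simp: real_differentiable_def)
    have p_deriv: "((\<lambda>s. p s (i, m)) has_real_derivative (\<Sum>w\<in>?S. p t w * ?G w (i, m)))
        (at t within {0..})" if "m \<in> {0..N}" for m
    proof (rule forward_equation[OF finite_edge_states assms(5) _ _ t])
      show "p (s + h) y = (\<Sum>w\<in>?S. p s w * P h w y)" if "0 \<le> s" "0 \<le> h" "y \<in> ?S" for s h y
        unfolding p_def
        by (rule markov_process_law_evolution[OF assms(6,5) finite_edge_states that])
      show "\<bar>p s w\<bar> \<le> 1" for s w by (simp add: p_def)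
      show "(i, m) \<in> ?S" using i that by (simp add: edge_states_def)
    qed
    have "((\<lambda>s. \<Sum>m=0..N. p s (i, m) * z ^ m) has_real_derivative
        (\<Sum>m=0..N. (\<Sum>w\<in>?S. p t w * ?G w (i, m)) * z ^ m)) (at t within {0..})"
      by (intro DERIV_sum DERIV_cmult_right p_deriv)
    then have "((\<lambda>s. \<phi> i s z) has_real_derivative
        (\<Sum>m=0..N. (\<Sum>w\<in>?S. p t w * ?G w (i, m)) * z ^ m)) (at t within {0..})"
      by (rule has_field_derivative_transform_within[where d = 1]) (use t phi in auto)
    then show "((\<lambda>s. \<phi> i s z) has_real_derivative
         ((\<Sum>j=1..d. \<phi> j t z * q j i)
          + mu i * (1 - z) * deriv (\<lambda>w. \<phi> i t w) z
          + lam i * real N * (z - 1) * \<phi> i t z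
          + lam i * z * (1 - z) * deriv (\<lambda>w. \<phi> i t w) z)) (at t within {0..})"
      by (simp only: edge_generator_pgf[OF assms(1) i phi[OF t]])
  }
  {
    fix \<pi> :: "(nat \<times> nat) pmf" and M' :: "'v measure" and X' Y' :: "'v \<Rightarrow> nat"
      and \<psi> :: "nat \<Rightarrow> real \<Rightarrow> real" and i and z :: real
    assume stat: "stationary_distribution ?S P \<pi>" and M': "prob_space M'"
      and meas: "(\<lambda>\<omega>. (X' \<omega>, Y' \<omega>)) \<in> measurable M' (count_space UNIV)"
      and law: "distr M' (count_space UNIV) (\<lambda>\<omega>. (X' \<omega>, Y' \<omega>)) = measure_pmf \<pi>"
      and \<psi>: "\<forall>i z. \<psi> i z = partial_pgf M' X' Y' i z"
      and i: "i \<in> {1..d}"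
    have point: "measure M' {\<omega> \<in> space M'. (X' \<omega>, Y' \<omega>) = y} = pmf \<pi> y" for y
    proof -
      have "pmf \<pi> y = measure (distr M' (count_space UNIV) (\<lambda>\<omega>. (X' \<omega>, Y' \<omega>))) {y}"
        by (simp add: law pmf.rep_eq)
      also have "\<dots> = measure M' {\<omega> \<in> space M'. (X' \<omega>, Y' \<omega>) = y}"
        by (subst measure_distr[OF meas]) (auto intro!: arg_cong[of _ _ "measure M'"])
      finally show ?thesis by simp
    qed
    have "AE y in distr M' (count_space UNIV) (\<lambda>\<omega>. (X' \<omega>, Y' \<omega>)). y \<in> ?S"
      unfolding law using stat by (auto simp: AE_measure_pmf_iff stationary_distribution_def)
    then have "AE \<omega> in M'. (X' \<omega>, Y' \<omega>) \<in> ?S"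
      by (subst (asm) AE_distr_iff[OF meas]) auto
    then have "AE \<omega> in M'. Y' \<omega> \<le> N"
      by eventually_elim (simp add: edge_states_def)
    from partial_pgf_eq_sum[OF M' meas this]
    have psi: "\<psi> j w = (\<Sum>m=0..N. pmf \<pi> (j, m) * w ^ m)" for j w
      using \<psi> by (simp only: point)
    show "\<psi> i differentiable (at z)"
    proof -
      have "\<psi> i = (\<lambda>w. \<Sum>m=0..N. pmf \<pi> (i, m) * w ^ m)" using psi by auto
      then show ?thesis
        using power_sum_has_derivative[of "\<lambda>m. pmf \<pi> (i, m)"]
        by (auto simp: real_differentiable_def)
    qed
    have balance: "(\<Sum>w\<in>?S. pmf \<pi> w * ?G w (i, m)) = 0" if "m \<in> {0..N}" for m
      using i that
      by (intro stationary_distribution_balance[OF stat assms(5) finite_edge_states])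
         (simp add: edge_states_def)
    have "(\<Sum>m=0..N. (\<Sum>w\<in>?S. pmf \<pi> w * ?G w (i, m)) * z ^ m) = 0"
      using balance by simp
    then show "0 = (\<Sum>j=1..d. \<psi> j z * q j i)
            + mu i * (1 - z) * deriv (\<psi> i) z
            + lam i * real N * (z - 1) * \<psi> i z
            + lam i * z * (1 - z) * deriv (\<psi> i) z"
      by (simp only: edge_generator_pgf[OF assms(1) i psi])
  }
qed

end
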